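(* Let $1\le s\le d$ be integers, $a,\sigma>0$, $0<\delta<1$. For any $0<\alpha'<1$, define $$\hat S_{\alpha'}=\Big\{j\in[d]:\ \frac{X_j}\sigma\ge\Big(\Phi^{-1}\big(\tfrac{\alpha'}{s}\big)+\frac a\sigma\Big)\vee\Phi^{-1}(\delta)\Big\}.$$ Then $\hat S_{\alpha'}\in\mathcal F(\delta)$. In addition, if $$\frac a\sigma\ge\kappa^*:=\Phi^{-1}(\delta)-\Phi^{-1}(\alpha'/s),$$ then $$\sup_{\theta\in\Theta^+(s,a)}\mathbb P_\theta\big(\mathrm{supp}(\theta)\not\subseteq\hat S_{\alpha'}\big)\le\alpha'.$$
   Context: $X=(X_1,\dots,X_d)\sim N(\theta,\sigma^2 I_d)$ with $\theta\in\mathbb R^d$ unknown and $\sigma>0$ known; $\mathbb P_\theta$ is the corresponding probability. $\Phi$ is the standard normal c.d.f., $x\vee y=\max(x,y)$, $[d]=\{1,\dots,d\}$, $\mathrm{supp}(\theta)=\{j:\theta_j\ne0\}$, $\|\theta\|_0=|\mathrm{supp}(\theta)|$. The parameter space is $$\Theta^+(s,a)=\{\theta\in\mathbb R^d:\ \|\theta\|_0\le s,\ \min_{j:\theta_j\neq0}\theta_j\ge a\}.$$ $\mathcal F(\delta)$ is the class of (measurable) random subsets $S=S(X)\subseteq[d]$ such that for every $j\in[d]$: the event $\{j\in S(X)\}$ depends only on $X_j$, and $\mathbb P_0(j\in S(X))\le1-\delta$, where $\mathbb P_0$ is the probability when $X_j\sim N(0,\sigma^2)$. *)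

theory Defs
  imports "HOL-Probability.Probability"
begin

text \<open>
  Vectors in \<open>\<real>\<^sup>d\<close> are extensional functions on \<open>{1..d}\<close>, i.e. elements of \<open>{1..d} \<rightarrow>\<^sub>E UNIV\<close>,
  which is also the sample space of the product measure below. Random sets are functions
  of the observation \<open>x\<close>, so probabilities are taken under the law of \<open>X\<close>.
\<close>

text \<open>The law \<open>N(\<theta>, \<sigma>\<^sup>2 I\<^sub>d)\<close>; the second parameter of \<^const>\<open>normal_density\<close> is the standard deviation.\<close>

definition normal_vec :: "nat \<Rightarrow> real \<Rightarrow> (nat \<Rightarrow> real) \<Rightarrow> (nat \<Rightarrow> real) measure" where
  "normal_vec d \<sigma> \<theta> =
     (\<Pi>\<^sub>M j\<in>{1..d}. density lborel (\<lambda>x. ennreal (normal_density (\<theta> j) \<sigma> x)))"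

definition std_normal_cdf :: "real \<Rightarrow> real" where
  "std_normal_cdf = cdf std_normal_distribution"

text \<open>Meaningful on \<open>{0<..<1}\<close>, the range of the (injective) function \<^const>\<open>std_normal_cdf\<close>.\<close>

definition std_normal_quantile :: "real \<Rightarrow> real" where
  "std_normal_quantile = inv std_normal_cdf"

definition supp :: "nat \<Rightarrow> (nat \<Rightarrow> real) \<Rightarrow> nat set" where
  "supp d \<theta> = {j \<in> {1..d}. \<theta> j \<noteq> 0}"

text \<open>The minimum over an empty support imposes no constraint, so the zero vector belongs to the space.\<close>

definition Theta_plus :: "nat \<Rightarrow> nat \<Rightarrow> real \<Rightarrow> (nat \<Rightarrow> real) set" where
  "Theta_plus d s a =
     {\<theta> \<in> {1..d} \<rightarrow>\<^sub>E UNIV. card (supp d \<theta>) \<le> s \<and> (\<forall>j\<in>supp d \<theta>. \<theta> j \<ge> a)}"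

text \<open>
  The event \<open>{j \<in> S(X)}\<close> depends only on \<open>X\<^sub>j\<close>: it has the form \<open>{X\<^sub>j \<in> A}\<close> for a Borel set \<open>A\<close>.
  Its probability is therefore the same under every mean vector with \<open>\<theta>\<^sub>j = 0\<close>; the zero mean
  vector is used. The \<open>\<sigma>\<close>-algebra of \<^term>\<open>normal_vec d \<sigma> \<theta>\<close> does not depend on \<open>\<theta>\<close>.
\<close>

definition selector_class :: "nat \<Rightarrow> real \<Rightarrow> real \<Rightarrow> ((nat \<Rightarrow> real) \<Rightarrow> nat set) set" where
  "selector_class d \<sigma> \<delta> =
     {S \<in> measurable (normal_vec d \<sigma> (\<lambda>_. 0)) (count_space (Pow {1..d})).
        \<forall>j\<in>{1..d}.
          (\<exists>A\<in>sets borel. \<forall>x\<in>space (normal_vec d \<sigma> (\<lambda>_. 0)). j \<in> S x \<longleftrightarrow> x j \<in> A) \<and>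
          \<P>(x in normal_vec d \<sigma> (\<lambda>_. 0). j \<in> S x) \<le> 1 - \<delta>}"

definition S_hat :: "nat \<Rightarrow> nat \<Rightarrow> real \<Rightarrow> real \<Rightarrow> real \<Rightarrow> real \<Rightarrow> (nat \<Rightarrow> real) \<Rightarrow> nat set" where
  "S_hat d s a \<sigma> \<delta> \<alpha> x =
     {j \<in> {1..d}. x j / \<sigma> \<ge>
        max (std_normal_quantile (\<alpha> / real s) + a / \<sigma>) (std_normal_quantile \<delta>)}"

definition kappa_star :: "nat \<Rightarrow> real \<Rightarrow> real \<Rightarrow> real" where
  "kappa_star s \<delta> \<alpha> = std_normal_quantile \<delta> - std_normal_quantile (\<alpha> / real s)"

end

theory Submission
  imports Defs
begin

text \<open>
  The threshold is at least \<open>\<Phi>\<inverse>(\<delta>)\<close>, which bounds the probability of selecting a null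
  coordinate by \<open>1 - \<delta>\<close>. When \<open>a / \<sigma> \<ge> \<kappa>\<^sup>*\<close> the maximum in the threshold is its first
  term, so a coordinate with mean \<open>\<theta>\<^sub>j \<ge> a\<close> is missed only if
  \<open>(X\<^sub>j - \<theta>\<^sub>j) / \<sigma> < \<Phi>\<inverse>(\<alpha> / s)\<close>, an event of probability \<open>\<alpha> / s\<close>; a union bound
  over the at most \<open>s\<close> nonzero coordinates concludes.
\<close>

text \<open>The law has a density with respect to \<open>lborel\<close>, so Lebesgue null sets are
  null for it. Absence of atoms gives both the continuity of \<open>std_normal_cdf\<close> and the
  freedom to pass between strict and weak inequalities.\<close>

lemma measure_std_normal_singleton: "measure std_normal_distribution {x} = 0"
proof -
  have "{x} \<in> null_sets std_normal_distribution"
    using absolutely_continuousI_density[of std_normal_density lborel]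
    by (auto simp: absolutely_continuous_def intro: finite_imp_null_set_lborel)
  then show ?thesis by (simp add: measure_eq_0_null_sets)
qed

text \<open>\<open>cdf\<close> measures closed half-lines, whereas missing a coordinate is a strict
  inequality; the endpoint carries no mass.\<close>

lemma std_normal_cdf_eq_lessThan: "std_normal_cdf q = measure std_normal_distribution {..<q}"
proof -
  interpret real_distribution std_normal_distribution
    by (rule real_dist_normal_dist)
  have "measure std_normal_distribution ({..<q} \<union> {q})
      = measure std_normal_distribution {..<q} + measure std_normal_distribution {q}"
    by (rule finite_measure_Union) auto
  moreover have "{..<q} \<union> {q} = {..q}" by auto
  ultimately show ?thesis
    by (simp add: std_normal_cdf_def cdf_def measure_std_normal_singleton)
qed

text \<open>\<open>inv\<close> inverts on the right at every point of the range, so it suffices that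
  \<open>p\<close> is attained. This follows from the limits 0 and 1 at infinity, continuity and the
  intermediate value theorem.\<close>

lemma std_normal_cdf_quantile:
  assumes "0 < p" "p < 1"
  shows "std_normal_cdf (std_normal_quantile p) = p"
proof -
  interpret real_distribution std_normal_distribution
    by (rule real_dist_normal_dist)
  have "eventually (\<lambda>x. std_normal_cdf x < p) at_bot"
    using cdf_lim_at_bot assms(1) unfolding std_normal_cdf_def by (rule order_tendstoD)
  then obtain l where l: "std_normal_cdf x < p" if "x \<le> l" for x
    by (auto simp: eventually_at_bot_linorder)
  have "eventually (\<lambda>x. p < std_normal_cdf x) at_top"
    using cdf_lim_at_top_prob assms(2) unfolding std_normal_cdf_def by (rule order_tendstoD)
  then obtain u where u: "p < std_normal_cdf x" if "x \<ge> u" for x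
    by (auto simp: eventually_at_top_linorder)
  have "isCont std_normal_cdf x" for x
    by (simp add: std_normal_cdf_def isCont_cdf measure_std_normal_singleton)
  \<comment> \<open>Taking \<open>max l u\<close> as right endpoint makes the interval nonempty
    without comparing \<open>l\<close> and \<open>u\<close>.\<close>
  then have "\<exists>x. l \<le> x \<and> x \<le> max l u \<and> std_normal_cdf x = p"
    using less_imp_le[OF l[of l]] less_imp_le[OF u[of "max l u"]] by (intro IVT) auto
  then have "p \<in> range std_normal_cdf" by auto
  then show ?thesis
    unfolding std_normal_quantile_def by (rule f_inv_into_f)
qed

text \<open>Standardization: the map \<open>(x - \<mu>) / \<sigma>\<close> pushes the normal law
  forward to the standard one, and the half-line below \<open>q\<close> pulls back to the one below
  \<open>\<mu> + \<sigma> * q\<close>.\<close>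

lemma measure_normal_lessThan:
  assumes "0 < \<sigma>"
  shows "measure (density lborel (\<lambda>x. ennreal (normal_density \<mu> \<sigma> x))) {..<\<mu> + \<sigma> * q}
    = std_normal_cdf q"
proof -
  define M where "M = density lborel (\<lambda>x. ennreal (normal_density \<mu> \<sigma> x))"
  interpret prob_space M
    unfolding M_def using assms by (rule prob_space_normal_density)
  \<comment> \<open>The identity on \<open>M\<close> serves as the random variable to be
    standardized.\<close>
  have "distributed M lborel (\<lambda>x. x) (normal_density \<mu> \<sigma>)"
    by (simp add: distributed_def M_def distr_id2)
  then have "distributed M lborel (\<lambda>x. (x - \<mu>) / \<sigma>) std_normal_density"
    by (simp only: normal_standard_normal_convert[OF assms])
  then have *: "distr M lborel (\<lambda>x. (x - \<mu>) / \<sigma>) = std_normal_distribution"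
    by (simp add: distributed_def)
  have "std_normal_cdf q = measure M ((\<lambda>x. (x - \<mu>) / \<sigma>) -` {..<q} \<inter> space M)"
    unfolding std_normal_cdf_eq_lessThan *[symmetric]
    by (rule measure_distr) (auto simp: M_def)
  also have "(\<lambda>x. (x - \<mu>) / \<sigma>) -` {..<q} \<inter> space M = {..<\<mu> + \<sigma> * q}"
    using assms by (auto simp: M_def field_simps)
  finally show ?thesis by (simp add: M_def)
qed

lemma prob_space_normal_vec: "0 < \<sigma> \<Longrightarrow> prob_space (normal_vec d \<sigma> \<theta>)"
  unfolding normal_vec_def by (intro prob_space_PiM prob_space_normal_density)

text \<open>The marginal of a product of probability measures is its factor. Centering the threshold
  at \<open>\<theta> j\<close> lets one formula serve null coordinates, with mean zero, and signal
  coordinates alike.\<close>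

lemma measure_normal_vec_component_less:
  assumes "0 < \<sigma>" "j \<in> {1..d}"
  shows "\<P>(x in normal_vec d \<sigma> \<theta>. x j < \<theta> j + \<sigma> * q) = std_normal_cdf q"
proof -
  let ?N = "\<lambda>j. density lborel (\<lambda>x. ennreal (normal_density (\<theta> j) \<sigma> x))"
  have *: "distr (Pi\<^sub>M {1..d} ?N) (?N j) (\<lambda>x. x j) = ?N j"
    using assms by (intro distr_PiM_component prob_space_normal_density) auto
  have "std_normal_cdf q = measure (?N j) {..<\<theta> j + \<sigma> * q}"
    by (rule measure_normal_lessThan[OF assms(1), symmetric])
  also have "\<dots> = measure (Pi\<^sub>M {1..d} ?N)
      ((\<lambda>x. x j) -` {..<\<theta> j + \<sigma> * q} \<inter> space (Pi\<^sub>M {1..d} ?N))"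
    by (subst *[symmetric], rule measure_distr) (use assms in auto)
  finally show ?thesis
    by (simp add: normal_vec_def vimage_def Int_def conj_commute)
qed

lemma sets_normal_vec: "sets (normal_vec d \<sigma> \<theta>) = sets (\<Pi>\<^sub>M j\<in>{1..d}. borel)"
  unfolding normal_vec_def by (rule sets_PiM_cong) auto

lemma measurable_normal_vec_component:
  "j \<in> {1..d} \<Longrightarrow> (\<lambda>x. x j) \<in> borel_measurable (normal_vec d \<sigma> \<theta>)"
  by (subst measurable_cong_sets[OF sets_normal_vec refl]) simp

text \<open>The target is finite, so preimages of singletons suffice, and each is a finite
  conjunction of conditions on single coordinates.\<close>

lemma measurable_S_hat:
  "S_hat d s a \<sigma> \<delta> \<alpha> \<in> measurable (normal_vec d \<sigma> \<theta>) (count_space (Pow {1..d}))"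
proof (rule measurable_count_space_eq2[THEN iffD2])
  show "finite (Pow {1..d})" by simp
  have "S_hat d s a \<sigma> \<delta> \<alpha> -` {B} \<inter> space (normal_vec d \<sigma> \<theta>) \<in> sets (normal_vec d \<sigma> \<theta>)"
    if "B \<in> Pow {1..d}" for B
  proof -
    let ?t = "max (std_normal_quantile (\<alpha> / real s) + a / \<sigma>) (std_normal_quantile \<delta>)"
    have "S_hat d s a \<sigma> \<delta> \<alpha> x = B \<longleftrightarrow> (\<forall>j\<in>{1..d}. (x j / \<sigma> \<ge> ?t) = (j \<in> B))" for x
      unfolding S_hat_def using that by blast
    then have "S_hat d s a \<sigma> \<delta> \<alpha> -` {B} \<inter> space (normal_vec d \<sigma> \<theta>)
      = {x \<in> space (normal_vec d \<sigma> \<theta>). \<forall>j\<in>{1..d}. (x j / \<sigma> \<ge> ?t) = (j \<in> B)}"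
      by blast
    also have "\<dots> \<in> sets (normal_vec d \<sigma> \<theta>)"
    proof (rule sets.sets_Collect_finite_All)
      fix j assume "j \<in> {1..d}"
      note [measurable] = measurable_normal_vec_component[OF this]
      show "{x \<in> space (normal_vec d \<sigma> \<theta>). (x j / \<sigma> \<ge> ?t) = (j \<in> B)}
        \<in> sets (normal_vec d \<sigma> \<theta>)"
        by measurable
    qed simp
    finally show ?thesis .
  qed
  then show "S_hat d s a \<sigma> \<delta> \<alpha> \<in> space (normal_vec d \<sigma> \<theta>) \<rightarrow> Pow {1..d} \<and>
     (\<forall>B\<in>Pow {1..d}. S_hat d s a \<sigma> \<delta> \<alpha> -` {B} \<inter> space (normal_vec d \<sigma> \<theta>)
        \<in> sets (normal_vec d \<sigma> \<theta>))"
    by (auto simp: S_hat_def)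
qed

lemma S_hat_in_selector_class:
  assumes "0 < \<sigma>" "0 < \<delta>" "\<delta> < 1"
  shows "S_hat d s a \<sigma> \<delta> \<alpha> \<in> selector_class d \<sigma> \<delta>"
proof -
  let ?M = "normal_vec d \<sigma> (\<lambda>_. 0)"
  let ?t = "max (std_normal_quantile (\<alpha> / real s) + a / \<sigma>) (std_normal_quantile \<delta>)"
  interpret prob_space ?M by (rule prob_space_normal_vec[OF assms(1)])
  have "\<exists>A\<in>sets borel. \<forall>x\<in>space ?M. j \<in> S_hat d s a \<sigma> \<delta> \<alpha> x \<longleftrightarrow> x j \<in> A"
    if "j \<in> {1..d}" for j
  proof (rule bexI)
    show "{y. y / \<sigma> \<ge> ?t} \<in> sets borel" by measurable
  qed (use that in \<open>auto simp: S_hat_def\<close>)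
  moreover have "\<P>(x in ?M. j \<in> S_hat d s a \<sigma> \<delta> \<alpha> x) \<le> 1 - \<delta>" if j: "j \<in> {1..d}" for j
  proof -
    note [measurable] = measurable_normal_vec_component[OF j]
    \<comment> \<open>The summand 0 is the mean of a null coordinate, matching the form
      \<open>\<theta> j + \<sigma> * q\<close>.\<close>
    let ?q = "0 + \<sigma> * std_normal_quantile \<delta>"
    \<comment> \<open>Only the second argument of the maximum is kept. The larger event is written
      as a negation so that its probability is a complement.\<close>
    have "\<P>(x in ?M. j \<in> S_hat d s a \<sigma> \<delta> \<alpha> x) \<le> \<P>(x in ?M. \<not> x j < ?q)"
      using assms(1) by (intro finite_measure_mono) (auto simp: S_hat_def field_simps)
    also have "\<dots> = 1 - \<P>(x in ?M. x j < ?q)"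
      by (rule prob_neg) measurable
    also have "\<P>(x in ?M. x j < ?q) = \<delta>"
      using measure_normal_vec_component_less[OF assms(1) j, of "\<lambda>_. 0"]
      by (simp add: std_normal_cdf_quantile assms)
    finally show ?thesis .
  qed
  ultimately show ?thesis
    using measurable_S_hat[of d s a \<sigma> \<delta> \<alpha> "\<lambda>_. 0"] unfolding selector_class_def by blast
qed

lemma prob_S_hat_misses_support:
  assumes "1 \<le> s" "0 < \<sigma>" "0 < \<alpha>" "\<alpha> < 1"
    and \<kappa>: "kappa_star s \<delta> \<alpha> \<le> a / \<sigma>"
    and \<theta>: "\<theta> \<in> Theta_plus d s a"
  shows "\<P>(x in normal_vec d \<sigma> \<theta>. \<not> supp d \<theta> \<subseteq> S_hat d s a \<sigma> \<delta> \<alpha> x) \<le> \<alpha>"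
proof -
  let ?M = "normal_vec d \<sigma> \<theta>"
  let ?q = "std_normal_quantile (\<alpha> / real s)"
  let ?E = "\<lambda>j. {x \<in> space ?M. x j < \<theta> j + \<sigma> * ?q}"
  interpret prob_space ?M by (rule prob_space_normal_vec[OF assms(2)])
  have supp: "supp d \<theta> \<subseteq> {1..d}" "finite (supp d \<theta>)" by (auto simp: supp_def)
  have ge: "a \<le> \<theta> j" if "j \<in> supp d \<theta>" for j
    using \<theta> that by (auto simp: Theta_plus_def)
  have E: "?E j \<in> events" if "j \<in> supp d \<theta>" for j
  proof -
    have [measurable]: "(\<lambda>x. x j) \<in> borel_measurable ?M"
      using that supp(1) by (intro measurable_normal_vec_component) auto
    show ?thesis by measurable
  qed
  \<comment> \<open>Since \<open>s\<close> is at least 1, the level lies in the open unit interval,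
    where the quantile inverts the c.d.f.\<close>
  have q: "\<alpha> / real s < 1" "0 < \<alpha> / real s"
    using assms by (auto simp: divide_less_eq)
  have max: "max (?q + a / \<sigma>) (std_normal_quantile \<delta>) = ?q + a / \<sigma>"
    using \<kappa> by (simp add: kappa_star_def)
  have "{x \<in> space ?M. \<not> supp d \<theta> \<subseteq> S_hat d s a \<sigma> \<delta> \<alpha> x} \<subseteq> (\<Union>j\<in>supp d \<theta>. ?E j)"
  proof
    fix x
    assume "x \<in> {x \<in> space ?M. \<not> supp d \<theta> \<subseteq> S_hat d s a \<sigma> \<delta> \<alpha> x}"
    then obtain j where x: "j \<in> supp d \<theta>" "j \<notin> S_hat d s a \<sigma> \<delta> \<alpha> x" "x \<in> space ?M"
      by blast
    then have "x j / \<sigma> < ?q + a / \<sigma>"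
      using supp(1) by (auto simp: S_hat_def max)
    then have "x j < \<sigma> * ?q + a"
      using assms(2) by (simp add: field_simps)
    \<comment> \<open>The bound \<open>a \<le> \<theta> j\<close> replaces the common threshold by
      one centered at \<open>\<theta> j\<close>, whose probability is the same for all
      coordinates.\<close>
    with x ge[of j] show "x \<in> (\<Union>j\<in>supp d \<theta>. ?E j)"
      by (intro UN_I[of j]) auto
  qed
  then have "\<P>(x in ?M. \<not> supp d \<theta> \<subseteq> S_hat d s a \<sigma> \<delta> \<alpha> x) \<le> prob (\<Union>j\<in>supp d \<theta>. ?E j)"
    using E supp(2) by (intro finite_measure_mono) auto
  also have "\<dots> \<le> (\<Sum>j\<in>supp d \<theta>. prob (?E j))"
    using E supp(2) by (intro finite_measure_subadditive_finite) auto
  also have "\<dots> = (\<Sum>j\<in>supp d \<theta>. \<alpha> / real s)"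
    using supp(1) q assms(2)
    by (intro sum.cong refl) (simp add: measure_normal_vec_component_less std_normal_cdf_quantile subset_iff)
  also have "\<dots> = real (card (supp d \<theta>)) * (\<alpha> / real s)" by simp
  also have "\<dots> \<le> real s * (\<alpha> / real s)"
    using \<theta> q by (intro mult_right_mono) (auto simp: Theta_plus_def)
  also have "\<dots> = \<alpha>" using assms(1) by simp
  finally show ?thesis .
qed

theorem theorem2p3:
  fixes d s :: nat and a \<sigma> \<delta> \<alpha> :: real
  assumes "1 \<le> s" and "s \<le> d"
    and "0 < a" and "0 < \<sigma>"
    and "0 < \<delta>" and "\<delta> < 1"
    and "0 < \<alpha>" and "\<alpha> < 1"
  shows "S_hat d s a \<sigma> \<delta> \<alpha> \<in> selector_class d \<sigma> \<delta> \<and>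
    (a / \<sigma> \<ge> kappa_star s \<delta> \<alpha> \<longrightarrow>
      (SUP \<theta>\<in>Theta_plus d s a.
         \<P>(x in normal_vec d \<sigma> \<theta>. \<not> supp d \<theta> \<subseteq> S_hat d s a \<sigma> \<delta> \<alpha> x)) \<le> \<alpha>)"
proof (intro conjI impI cSUP_least)
  \<comment> \<open>A real supremum is bounded by \<open>cSUP_least\<close> only over a nonempty
    set. The zero vector is a member; restricting it to \<open>{1..d}\<close> makes it
    extensional.\<close>
  have "supp d (\<lambda>j\<in>{1..d}. 0) = {}" by (auto simp: supp_def)
  then have "(\<lambda>j\<in>{1..d}. 0) \<in> Theta_plus d s a" by (simp add: Theta_plus_def)
  then show "Theta_plus d s a \<noteq> {}" by blast
qed (use assms in \<open>auto intro: S_hat_in_selector_class prob_S_hat_misses_support\<close>)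

end
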